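(* Let $m\geq 1$ be an integer, let $x_1<\cdots<x_{2m}$ be real numbers, and let $r\geq m-1$ be an integer with $r\ge 0$. Then $$(-1)^{\binom m2}\operatorname{Pf}\bigl[(x_j-x_i)^{2r+1}\bigr]_{i,j=1}^{2m}>0.$$ Consequently, $$\det\bigl[(x_j-x_i)^{2r+1}\bigr]_{i,j=1}^{2m}>0.$$
   Context: $\operatorname{Pf}$ is the Pfaffian of a skew-symmetric matrix of even size, normalized so that $\operatorname{Pf}\begin{pmatrix}0&a\\-a&0\end{pmatrix}=a$. The $(i,j)$ entry of the matrix is $(x_j-x_i)^{2r+1}$. (The condition $r\ge 0$ is implied by $r\geq m-1$ and $m\geq 1$.) *)

theory Defs
  imports Complex_Main "Jordan_Normal_Form.Determinant"
begin

text \<open>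
  Indices start at 0: the mathematical indices \<open>1, \<dots>, 2n\<close> become \<open>0, \<dots>, 2n - 1\<close>, and the
  pairs \<open>(\<sigma>(2i-1), \<sigma>(2i))\<close> become \<open>(p (2i), p (2i+1))\<close>.
  The value is meaningful for skew-symmetric \<open>A\<close> of even size; skew-symmetry is not
  tested, and any matrix that is not square of even size gets the value 0.
\<close>

definition pfaffian :: "'a :: field_char_0 mat \<Rightarrow> 'a" where
  "pfaffian A =
    (if dim_row A = dim_col A \<and> even (dim_row A)
     then let n = dim_row A div 2 in
       (\<Sum>p | p permutes {0 ..< 2 * n}. signof p * (\<Prod>i = 0 ..< n. A $$ (p (2 * i), p (2 * i + 1))))
         / (2 ^ n * fact n)
     else 0)"

lemma pfaffian_2x2:
  "pfaffian (mat_of_rows_list 2 [[0, a], [- a, 0]]) = (a :: 'a :: field_char_0)"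
proof -
  have S: "{0 ..< 2 :: nat} = insert 0 (insert 1 {})" by auto
  have "{p. p permutes {0 ..< 2 :: nat}} = {id, transpose 0 1}"
    unfolding S permutes_insert by (auto simp: image_iff) (rule exI[of _ 0], simp)
  moreover have "id \<noteq> (transpose 0 1 :: nat \<Rightarrow> nat)"
    by (metis id_apply transpose_apply_first zero_neq_one)
  moreover have "signof (transpose 0 1 :: nat \<Rightarrow> nat) = (- 1 :: 'a)"
    by (simp add: sign_swap_id)
  moreover have "signof (id :: nat \<Rightarrow> nat) = (1 :: 'a)"
    by simp
  ultimately show ?thesis
    by (simp add: pfaffian_def mat_of_rows_list_def)
qed

definition odd_power_matrix :: "nat \<Rightarrow> nat \<Rightarrow> (nat \<Rightarrow> real) \<Rightarrow> real mat" where
  "odd_power_matrix m r x = mat (2 * m) (2 * m) (\<lambda>(i, j). (x j - x i) ^ (2 * r + 1))"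

end

theory Submission
  imports Defs
begin

text \<open>
  The sign of the Pfaffian is found by induction on \<open>m\<close>; each step trades the pair
  \<open>(m + 1, r)\<close> for \<open>(m, r - 1)\<close> and costs a factor \<open>(- 1) ^ m\<close>, and these
  factors multiply up to \<open>(- 1) ^ (m choose 2)\<close>. Write \<open>D = 2 * r + 1\<close>.

  The kernel \<open>(t - s) ^ D\<close> is projectively invariant: the substitution
  \<open>y i = - 1 / (x i - x 0)\<close> keeps the order of the points after the first one and turns
  \<open>(x j - x i) ^ D\<close> into \<open>(y j - y i) ^ D\<close> up to positive row and column factors, while
  the first point moves to infinity and its row becomes \<open>(0, 1, \<dots>, 1)\<close>. Subtracting from every
  later row and column its predecessor leaves \<open>(0, 1, 0, \<dots>, 0)\<close> there, so the Pfaffian equals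
  the Pfaffian of the second differences of \<open>(t - s) ^ D\<close> over the consecutive intervals
  between the \<open>y i\<close> (\<open>pfaffian_first_point_to_infinity\<close>).

  A Pfaffian is linear in each of its indices, where changing an index means changing a row together
  with the column of the same number. Hence the mean value theorem applies to one index after another
  and replaces each difference by a derivative at a point \<open>\<xi> i\<close> inside the interval, times the
  length of the interval (\<open>pairing_pfaffian_mvt_all\<close>). It is essential that the row and the column
  of an index move together, so that the same \<open>\<xi> i\<close> serves both. The mixed second derivative of
  \<open>(t - s) ^ D\<close> is \<open>- D * (D - 1) * (t - s) ^ (D - 2)\<close>. As the intervals are consecutive,
  the \<open>\<xi> i\<close> are increasing, and what is left is \<open>(- 1) ^ m\<close> times a positive number times
  the Pfaffian of the same shape for \<open>m\<close> and exponent \<open>D - 2\<close>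
  (\<open>pfaffian_power_differences\<close>).

  The determinant is positive because it is the square of the Pfaffian
  (\<open>det_eq_pfaffian_square\<close>).
\<close>

section \<open>Pfaffians and congruence\<close>

lemma pfaffian_permutation_sum:
  assumes "A \<in> carrier_mat (2 * n) (2 * n)"
  shows "pfaffian A = (\<Sum>p | p permutes {0 ..< 2 * n}.
    signof p * (\<Prod>l = 0 ..< n. A $$ (p (2 * l), p (2 * l + 1)))) / (2 ^ n * fact n)"
  using assms by (auto simp: pfaffian_def Let_def)

lemma pfaffian_0x0: "A \<in> carrier_mat 0 0 \<Longrightarrow> pfaffian A = 1"
  using pfaffian_permutation_sum[of A 0] by simp

lemma prod_pairs:
  fixes f :: "nat \<Rightarrow> 'a :: comm_monoid_mult"
  shows "(\<Prod>i = 0 ..< 2 * n. f i) = (\<Prod>l = 0 ..< n. f (2 * l) * f (2 * l + 1))"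
  by (induction n) (simp_all add: mult.assoc)

text \<open>
  Each entry of \<open>P * A * P\<^sup>T\<close> is a double sum. Multiplying out the products over the
  pairs \<open>(p (2 * l), p (2 * l + 1))\<close> yields a sum over all functions \<open>\<phi>\<close> that choose a
  column of \<open>P\<close> for each position; for fixed \<open>\<phi>\<close> the signed sum over \<open>p\<close> is the
  determinant of the matrix of the chosen columns.
\<close>

lemma pfaffian_congruence:
  fixes A P :: "'a :: field_char_0 mat"
  assumes A: "A \<in> carrier_mat (2 * n) (2 * n)" and P: "P \<in> carrier_mat (2 * n) (2 * n)"
  shows "pfaffian (P * A * P\<^sup>T) = det P * pfaffian A"
proof -
  let ?S = "{0 ..< 2 * n}"
  let ?Perm = "{p. p permutes ?S}"
  define G where "G = PiE {0 ..< n} (\<lambda>_. ?S \<times> ?S)"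
  \<comment> \<open>A choice of columns is stored as a function on pairs of positions, since the products run over
    pairs; \<open>\<phi> g\<close> reads it as a function on positions, and \<open>pairs\<close> is its inverse.\<close>
  define \<phi> where "\<phi> g i = (if even i then fst else snd) (g (i div 2))"
    for g :: "nat \<Rightarrow> nat \<times> nat" and i :: nat
  define a where "a g = (\<Prod>l = 0 ..< n. A $$ g l)" for g
  define pairs where "pairs q = restrict (\<lambda>l. (q (2 * l), q (2 * l + 1))) {0 ..< n}"
    for q :: "nat \<Rightarrow> nat"
  have finG: "finite G" unfolding G_def by (intro finite_PiE) auto
  have entry: "(P * A * P\<^sup>T) $$ (i, j) =
      (\<Sum>kh \<in> ?S \<times> ?S. A $$ kh * (P $$ (i, fst kh) * P $$ (j, snd kh)))"
    if "i < 2 * n" "j < 2 * n" for i j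
  proof -
    have "(P * A * P\<^sup>T) $$ (i, j) = (\<Sum>k\<in>?S. P $$ (i, k) * (\<Sum>h\<in>?S. A $$ (k, h) * P $$ (j, h)))"
      using that A P by (simp add: scalar_prod_def)
    also have "\<dots> = (\<Sum>k\<in>?S. \<Sum>h\<in>?S. A $$ (k, h) * (P $$ (i, k) * P $$ (j, h)))"
      by (simp add: sum_distrib_left mult_ac)
    finally show ?thesis by (simp add: sum.cartesian_product case_prod_unfold)
  qed
  have expand: "(\<Prod>l = 0 ..< n. (P * A * P\<^sup>T) $$ (p (2 * l), p (2 * l + 1))) =
      (\<Sum>g\<in>G. a g * (\<Prod>i\<in>?S. P $$ (p i, \<phi> g i)))" if p: "p permutes ?S" for p
  proof -
    have lt: "p i < 2 * n" if "i < 2 * n" for i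
      using permutes_in_image[OF p, of i] that by auto
    have "(\<Prod>l = 0 ..< n. (P * A * P\<^sup>T) $$ (p (2 * l), p (2 * l + 1))) =
        (\<Prod>l = 0 ..< n. \<Sum>kh \<in> ?S \<times> ?S.
          A $$ kh * (P $$ (p (2 * l), fst kh) * P $$ (p (2 * l + 1), snd kh)))"
      by (intro prod.cong refl entry lt) auto
    also have "\<dots> = (\<Sum>g\<in>G. \<Prod>l = 0 ..< n.
          A $$ g l * (P $$ (p (2 * l), fst (g l)) * P $$ (p (2 * l + 1), snd (g l))))"
      unfolding G_def by (rule prod_sum_PiE) auto
    finally show ?thesis
      unfolding a_def \<phi>_def prod_pairs by (simp add: prod.distrib)
  qed
  have detcol: "(\<Sum>p\<in>?Perm. signof p * (\<Prod>i\<in>?S. P $$ (p i, \<phi> g i))) =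
      det (mat (2 * n) (2 * n) (\<lambda>(i, j). P $$ (i, \<phi> g j)))" for g
  proof -
    let ?M = "mat (2 * n) (2 * n) (\<lambda>(i, j). P $$ (i, \<phi> g j))"
    have "det ?M = (\<Sum>p\<in>?Perm. signof p * (\<Prod>i<2 * n. ?M $$ (p i, i)))"
      by (rule det_col) simp
    also have "\<dots> = (\<Sum>p\<in>?Perm. signof p * (\<Prod>i\<in>?S. P $$ (p i, \<phi> g i)))"
    proof (intro sum.cong refl arg_cong2[where f = "(*)"] prod.cong)
      fix p i assume "p \<in> ?Perm" "i \<in> ?S"
      then show "?M $$ (p i, i) = P $$ (p i, \<phi> g i)"
        using permutes_in_image[of p ?S i] by auto
    qed auto
    finally show ?thesis ..
  qed
  have \<phi>_pairs: "\<phi> (pairs q) i = q i" if "i < 2 * n" for q i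
    using that by (auto simp: \<phi>_def pairs_def less_mult_imp_div_less mult.commute elim!: oddE evenE)
  have \<phi>_lt: "\<phi> g i < 2 * n" if "g \<in> G" "i < 2 * n" for g i
  proof -
    have "g (i div 2) \<in> ?S \<times> ?S" using that unfolding G_def by (auto simp: PiE_iff)
    then show ?thesis by (auto simp: \<phi>_def)
  qed
  have pairs_G: "pairs q \<in> G" if "q permutes ?S" for q
    using permutes_in_image[OF that] by (auto simp: pairs_def G_def)
  \<comment> \<open>Only choices of columns without repetition survive, and these are the permutations.\<close>
  have det_zero: "det (mat (2 * n) (2 * n) (\<lambda>(i, j). P $$ (i, \<phi> g j))) = 0"
    if g: "g \<in> G - pairs ` ?Perm" for g
  proof -
    have "\<not> inj_on (\<phi> g) ?S"
    proof
      assume inj: "inj_on (\<phi> g) ?S"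
      define q where "q i = (if i \<in> ?S then \<phi> g i else i)" for i
      have "\<phi> g ` ?S \<subseteq> ?S" using \<phi>_lt g by auto
      then have "bij_betw (\<phi> g) ?S ?S"
        using inj endo_inj_surj[of ?S "\<phi> g"] by (auto simp: bij_betw_def)
      then have "bij_betw q ?S ?S" by (rule bij_betw_cong[THEN iffD1, rotated]) (simp add: q_def)
      then have "q permutes ?S" by (rule bij_imp_permutes) (simp add: q_def)
      moreover have "pairs q = g"
        using g by (auto simp: pairs_def q_def \<phi>_def G_def fun_eq_iff PiE_iff extensional_def)
      ultimately show False using g by auto
    qed
    then obtain i j where "i < 2 * n" "j < 2 * n" "i \<noteq> j" "\<phi> g i = \<phi> g j"
      by (auto simp: inj_on_def)
    then show ?thesis by (intro det_identical_columns[of _ "2 * n" i j]) auto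
  qed
  have det_perm: "det (mat (2 * n) (2 * n) (\<lambda>(i, j). P $$ (i, \<phi> (pairs q) j))) = signof q * det P"
    if q: "q permutes ?S" for q
  proof -
    have lt: "q i < 2 * n" if "i < 2 * n" for i
      using permutes_in_image[OF q, of i] that by auto
    have "mat (2 * n) (2 * n) (\<lambda>(i, j). P $$ (i, \<phi> (pairs q) j)) =
        (mat (2 * n) (2 * n) (\<lambda>(i, j). P\<^sup>T $$ (q i, j)))\<^sup>T"
      using P by (intro eq_matI) (auto simp: \<phi>_pairs lt)
    also have "det \<dots> = signof q * det (P\<^sup>T)"
      using P q by (subst det_transpose[of _ "2 * n"]) (auto intro!: det_permute_rows)
    finally show ?thesis using P by (simp add: det_transpose)
  qed
  have inj_pairs: "inj_on pairs ?Perm"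
  proof (rule inj_onI)
    fix p q assume *: "p \<in> ?Perm" "q \<in> ?Perm" "pairs p = pairs q"
    have "p i = q i" for i
      using * \<phi>_pairs[of i p] \<phi>_pairs[of i q] permutes_not_in[of p ?S i] permutes_not_in[of q ?S i]
      by (cases "i < 2 * n") auto
    then show "p = q" by auto
  qed
  have "(\<Sum>p\<in>?Perm. signof p * (\<Prod>l = 0 ..< n. (P * A * P\<^sup>T) $$ (p (2 * l), p (2 * l + 1)))) =
      (\<Sum>p\<in>?Perm. \<Sum>g\<in>G. a g * (signof p * (\<Prod>i\<in>?S. P $$ (p i, \<phi> g i))))"
    by (intro sum.cong refl) (simp only: mem_Collect_eq expand sum_distrib_left mult.left_commute)
  also have "\<dots> = (\<Sum>g\<in>G. a g * det (mat (2 * n) (2 * n) (\<lambda>(i, j). P $$ (i, \<phi> g j))))"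
    by (subst sum.swap) (simp add: sum_distrib_left[symmetric] detcol)
  also have "\<dots> = (\<Sum>g\<in>pairs ` ?Perm. a g * det (mat (2 * n) (2 * n) (\<lambda>(i, j). P $$ (i, \<phi> g j))))"
    using finG pairs_G by (intro sum.mono_neutral_right) (auto simp: det_zero)
  also have "\<dots> = (\<Sum>q\<in>?Perm. a (pairs q) * (signof q * det P))"
    by (subst sum.reindex[OF inj_pairs]) (simp add: det_perm)
  also have "\<dots> = det P * (\<Sum>q\<in>?Perm. signof q * (\<Prod>l = 0 ..< n. A $$ (q (2 * l), q (2 * l + 1))))"
    by (simp add: sum_distrib_left a_def pairs_def mult_ac)
  finally show ?thesis
    using A P by (simp add: pfaffian_permutation_sum[of _ n])
qed

lemma pfaffian_smult:
  assumes A: "A \<in> carrier_mat (2 * n) (2 * n)"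
  shows "pfaffian (c \<cdot>\<^sub>m A) = c ^ n * pfaffian A"
proof -
  have "(\<Prod>l = 0 ..< n. (c \<cdot>\<^sub>m A) $$ (p (2 * l), p (2 * l + 1))) =
      c ^ n * (\<Prod>l = 0 ..< n. A $$ (p (2 * l), p (2 * l + 1)))"
    if p: "p permutes {0 ..< 2 * n}" for p
  proof -
    have "p i < 2 * n" if "i < 2 * n" for i
      using permutes_in_image[OF p, of i] that by auto
    then have "(\<Prod>l = 0 ..< n. (c \<cdot>\<^sub>m A) $$ (p (2 * l), p (2 * l + 1))) =
        (\<Prod>l = 0 ..< n. c * A $$ (p (2 * l), p (2 * l + 1)))"
      using A by (intro prod.cong refl) simp
    then show ?thesis by (simp add: prod.distrib)
  qed
  then show ?thesis
    using A by (simp add: pfaffian_permutation_sum[of _ n] sum_distrib_left mult_ac)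
qed

section \<open>Expansion along a sparse first row\<close>

lemma skew_mat_entry:
  assumes "A \<in> carrier_mat n n" "A\<^sup>T = - A" "i < n" "j < n"
  shows "A $$ (j, i) = - A $$ (i, j)"
proof -
  have "A $$ (j, i) = A\<^sup>T $$ (i, j)" using assms(1,3,4) by simp
  also have "\<dots> = (- A) $$ (i, j)" unfolding assms(2) ..
  finally show ?thesis using assms(1,3,4) by simp
qed

text \<open>
  Sort the permutations by the position of the index 0. Exchanging two pairs of positions changes
  neither the sign nor the product, and exchanging the two positions of one pair changes the sign of
  both. So all positions contribute equally, and the position 0 may be assumed. Then only
  permutations with \<open>p 1 = 1\<close> survive, and they are the permutations of the remaining indices.
\<close>

lemma pfaffian_expand_first_row:
  fixes A :: "'a :: field_char_0 mat"
  assumes A: "A \<in> carrier_mat (2 * Suc n) (2 * Suc n)"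
    and skew_A: "A\<^sup>T = - A"
    and row0: "\<And>j. j < 2 * Suc n \<Longrightarrow> j \<noteq> 1 \<Longrightarrow> A $$ (0, j) = 0"
  shows "pfaffian A = A $$ (0, 1) * pfaffian (mat (2 * n) (2 * n) (\<lambda>(i, j). A $$ (i + 2, j + 2)))"
proof -
  note skew = skew_mat_entry[OF A skew_A]
  let ?S = "{0 ..< 2 * Suc n}"
  let ?B = "mat (2 * n) (2 * n) (\<lambda>(i, j). A $$ (i + 2, j + 2))"
  define T where "T p = signof p * (\<Prod>l = 0 ..< Suc n. A $$ (p (2 * l), p (2 * l + 1)))"
    for p :: "nat \<Rightarrow> nat"
  define U where "U c = (\<Sum>p | p permutes ?S \<and> p c = 0. T p)" for c
  have U_transfer: "U (\<tau> c) = U c"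
    if \<tau>: "\<tau> permutes ?S" "\<And>i. \<tau> (\<tau> i) = i"
      and T: "\<And>p. p permutes ?S \<Longrightarrow> T (p \<circ> \<tau>) = T p" for \<tau> c
    unfolding U_def
    by (rule sum.reindex_bij_witness[of _ "\<lambda>p. p \<circ> \<tau>" "\<lambda>p. p \<circ> \<tau>"])
      (use \<tau> in \<open>auto simp: fun_eq_iff T intro: permutes_compose\<close>)
  have sign_comp: "sign (p \<circ> \<tau>) = sign p * sign \<tau>" if "p permutes ?S" "\<tau> permutes ?S" for p \<tau>
    using that by (intro sign_compose) (auto intro: permutation_permutes[THEN iffD2] exI[of _ ?S])
  \<comment> \<open>Exchange of the two positions of one pair.\<close>
  have U_odd: "U (2 * l + 1) = U (2 * l)" if l: "l < Suc n" for l
  proof -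
    let ?\<tau> = "transpose (2 * l) (2 * l + 1)"
    have \<tau>: "?\<tau> permutes ?S" using l by (intro permutes_swap_id) auto
    have "T (p \<circ> ?\<tau>) = T p" if p: "p permutes ?S" for p
    proof -
      have lt: "p i < 2 * Suc n" if "i < 2 * Suc n" for i
        using permutes_in_image[OF p, of i] that by auto
      have other: "A $$ ((p \<circ> ?\<tau>) (2 * k), (p \<circ> ?\<tau>) (2 * k + 1)) = A $$ (p (2 * k), p (2 * k + 1))"
        if "k \<noteq> l" for k
      proof -
        have "2 * k \<noteq> 2 * l + 1" "2 * k + 1 \<noteq> 2 * l" by presburger+
        then show ?thesis using that by (simp add: transpose_def)
      qed
      have "(\<Prod>k = 0 ..< Suc n. A $$ ((p \<circ> ?\<tau>) (2 * k), (p \<circ> ?\<tau>) (2 * k + 1))) =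
          A $$ (p (2 * l + 1), p (2 * l)) *
          (\<Prod>k\<in>{0 ..< Suc n} - {l}. A $$ (p (2 * k), p (2 * k + 1)))"
        using l by (subst prod.remove[of _ l]) (auto simp del: o_apply simp: other[simplified] intro!: prod.cong, simp)
      also have "A $$ (p (2 * l + 1), p (2 * l)) = - A $$ (p (2 * l), p (2 * l + 1))"
        using l by (intro skew lt) auto
      also have "- A $$ (p (2 * l), p (2 * l + 1)) *
          (\<Prod>k\<in>{0 ..< Suc n} - {l}. A $$ (p (2 * k), p (2 * k + 1))) =
          - (\<Prod>k = 0 ..< Suc n. A $$ (p (2 * k), p (2 * k + 1)))"
        using l by (subst (2) prod.remove[of _ l]) auto
      finally show ?thesis
        unfolding T_def sign_comp[OF p \<tau>] by (simp add: sign_swap_id)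
    qed
    then show ?thesis using U_transfer[OF \<tau>, of "2 * l"] by simp
  qed
  \<comment> \<open>Exchange of the pair at \<open>l\<close> with the pair at 0: an even permutation, being a product of two
    transpositions.\<close>
  have U_even: "U (2 * l) = U 0" if l: "l < Suc n" for l
  proof (cases "l = 0")
    case False
    let ?\<tau> = "transpose 0 (2 * l) \<circ> transpose 1 (2 * l + 1)"
    have \<tau>: "?\<tau> permutes ?S"
      using l by (intro permutes_compose permutes_swap_id) auto
    have \<tau>_even: "?\<tau> (2 * k) = 2 * transpose 0 l k" for k
    proof -
      have "2 * k \<noteq> 2 * l + 1" "2 * k \<noteq> 1" by presburger+
      then show ?thesis by (auto simp: transpose_def)
    qed
    have \<tau>_odd: "?\<tau> (2 * k + 1) = 2 * transpose 0 l k + 1" for k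
    proof -
      have "2 * k + 1 \<noteq> 2 * l" "1 \<noteq> 2 * l" by presburger+
      then show ?thesis by (auto simp: transpose_def)
    qed
    have \<tau>_inv: "?\<tau> (?\<tau> i) = i" for i
      by (cases "even i") (metis \<tau>_even \<tau>_odd transpose_involutory evenE oddE)+
    have sign_\<tau>: "sign ?\<tau> = 1"
      using False by (subst sign_compose) (auto simp: sign_swap_id permutation_swap_id)
    have T: "T (p \<circ> ?\<tau>) = T p" if p: "p permutes ?S" for p
    proof -
      have "(\<Prod>k = 0 ..< Suc n. A $$ ((p \<circ> ?\<tau>) (2 * k), (p \<circ> ?\<tau>) (2 * k + 1))) =
          (\<Prod>k = 0 ..< Suc n. A $$ (p (2 * transpose 0 l k), p (2 * transpose 0 l k + 1)))"
        using \<tau>_even \<tau>_odd by (metis comp_apply)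
      also have "\<dots> = (\<Prod>k = 0 ..< Suc n. A $$ (p (2 * k), p (2 * k + 1)))"
        using l by (intro prod.reindex_bij_betw[of "transpose 0 l"] permutes_imp_bij permutes_swap_id) auto
      finally show ?thesis unfolding T_def sign_comp[OF p \<tau>] sign_\<tau> by simp
    qed
    have "?\<tau> 0 = 2 * l" using \<tau>_even[of 0] by simp
    moreover have "U (?\<tau> 0) = U 0"
      by (rule U_transfer[of "?\<tau>" 0]) (use \<tau> \<tau>_inv T in blast)+
    ultimately show ?thesis by argo
  qed simp
  have "(\<Sum>p | p permutes ?S. T p) = (\<Sum>c\<in>?S. \<Sum>p | p \<in> {p. p permutes ?S} \<and> Hilbert_Choice.inv p 0 = c. T p)"
    by (rule sum.group[symmetric])
      (auto simp: finite_permutations permutes_in_image[OF permutes_inv, of _ ?S 0, simplified])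
  also have "\<dots> = (\<Sum>c\<in>?S. U c)"
    unfolding U_def by (intro sum.cong refl) (auto simp: permutes_inv_eq)
  also have "\<dots> = (\<Sum>c\<in>?S. U 0)"
  proof (intro sum.cong refl)
    fix c assume "c \<in> ?S"
    then show "U c = U 0"
      using U_even[of "c div 2"] U_odd[of "c div 2"] by (cases "even c") (auto elim!: evenE oddE)
  qed
  also have "\<dots> = of_nat (2 * Suc n) * U 0" by simp
  also have "U 0 = (\<Sum>p | p permutes ?S \<and> p 0 = 0 \<and> p 1 = 1. T p)"
    unfolding U_def
  proof (rule sum.mono_neutral_right)
    show "\<forall>p \<in> {p. p permutes ?S \<and> p 0 = 0} - {p. p permutes ?S \<and> p 0 = 0 \<and> p 1 = 1}. T p = 0"
    proof
      fix p assume p: "p \<in> {p. p permutes ?S \<and> p 0 = 0} - {p. p permutes ?S \<and> p 0 = 0 \<and> p 1 = 1}"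
      then have "p 1 < 2 * Suc n" using permutes_in_image[of p ?S 1] by auto
      then have "A $$ (p 0, p 1) = 0" using p row0 by auto
      then show "T p = 0" unfolding T_def by (subst prod.atLeast0_lessThan_Suc_shift) simp
    qed
  qed (auto intro: finite_subset[OF _ finite_permutations[of ?S]])
  also have "\<dots> = (\<Sum>q | q permutes {0 ..< 2 * n}.
      A $$ (0, 1) * (signof q * (\<Prod>l = 0 ..< n. ?B $$ (q (2 * l), q (2 * l + 1)))))"
  proof (rule sum.reindex_bij_witness[of _ "map_permutation {0 ..< 2 * n} (\<lambda>i. i + 2)"
        "map_permutation {2 ..< 2 * Suc n} (\<lambda>i. i - 2)"])
    have img: "(\<lambda>i. i + 2) ` {0 ..< 2 * n} = {2 ..< 2 * Suc n}"
      using image_add_atLeastLessThan'[of 2 0 "2 * n"] by (simp add: numeral_2_eq_2)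
    have img': "(\<lambda>i. i - 2) ` {2 ..< 2 * Suc n} = {0 ..< 2 * n}"
      unfolding img[symmetric] image_image by simp
    have inj: "inj_on (\<lambda>i. i - 2) {2 ..< 2 * Suc n}" by (auto simp: inj_on_def)
    have bij: "bij_betw (\<lambda>i. i + 2) {0 ..< 2 * n} {2 ..< 2 * Suc n}"
      using img by (auto simp: bij_betw_def inj_on_def)
    have bij': "bij_betw (\<lambda>i. i - 2) {2 ..< 2 * Suc n} {0 ..< 2 * n}"
      using img' inj by (auto simp: bij_betw_def)
    fix p assume "p \<in> {p. p permutes ?S \<and> p 0 = 0 \<and> p 1 = 1}"
    then have pS: "p permutes ?S" and p01: "p 0 = 0" "p 1 = 1" by auto
    have p: "p permutes {2 ..< 2 * Suc n}"
    proof (rule permutes_superset[OF pS])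
      fix i assume "i \<in> ?S - {2 ..< 2 * Suc n}"
      then have "i = 0 \<or> i = 1" by auto
      then show "p i = i" using p01 by auto
    qed
    let ?q = "map_permutation {2 ..< 2 * Suc n} (\<lambda>i. i - 2) p"
    show "map_permutation {0 ..< 2 * n} (\<lambda>i. i + 2) ?q = p"
      by (rule map_permutation_compose_inv[OF bij' p]) auto
    show q: "?q \<in> {q. q permutes {0 ..< 2 * n}}"
      using map_permutation_permutes[OF bij' p] by simp
    have q_eq: "?q i + 2 = p (i + 2)" and q_lt: "?q i < 2 * n" if "i < 2 * n" for i
      using map_permutation_apply[OF inj, of "i + 2" p] permutes_in_image[OF p, of "i + 2"] that
      by auto
    have "(\<Prod>l = 0 ..< Suc n. A $$ (p (2 * l), p (2 * l + 1))) =
        A $$ (0, 1) * (\<Prod>l = 0 ..< n. A $$ (p (2 * l + 2), p (2 * l + 1 + 2)))"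
      by (subst prod.atLeast0_lessThan_Suc_shift) (use p01 in simp)
    also have "(\<Prod>l = 0 ..< n. A $$ (p (2 * l + 2), p (2 * l + 1 + 2))) =
        (\<Prod>l = 0 ..< n. ?B $$ (?q (2 * l), ?q (2 * l + 1)))"
    proof (rule prod.cong[OF refl])
      fix l assume "l \<in> {0 ..< n}"
      then have l: "2 * l < 2 * n" "2 * l + 1 < 2 * n" by auto
      show "A $$ (p (2 * l + 2), p (2 * l + 1 + 2)) = ?B $$ (?q (2 * l), ?q (2 * l + 1))"
        unfolding q_eq[OF l(1), symmetric] q_eq[OF l(2), symmetric]
        using q_lt[OF l(1)] q_lt[OF l(2)] by simp
    qed
    finally show "A $$ (0, 1) * (signof ?q * (\<Prod>l = 0 ..< n. ?B $$ (?q (2 * l), ?q (2 * l + 1)))) = T p"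
      using sign_map_permutation[OF inj p] by (simp add: T_def)
  next
    fix q assume "q \<in> {q. q permutes {0 ..< 2 * n}}"
    then have q: "q permutes {0 ..< 2 * n}" by simp
    have bij: "bij_betw (\<lambda>i. i + 2) {0 ..< 2 * n} {2 ..< 2 * Suc n}"
      using image_add_atLeastLessThan'[of 2 0 "2 * n"] by (auto simp: bij_betw_def inj_on_def numeral_2_eq_2)
    let ?p = "map_permutation {0 ..< 2 * n} (\<lambda>i. i + 2) q"
    show "map_permutation {2 ..< 2 * Suc n} (\<lambda>i. i - 2) ?p = q"
      by (rule map_permutation_compose_inv[OF bij q]) auto
    have p: "?p permutes {2 ..< 2 * Suc n}" by (rule map_permutation_permutes[OF bij q])
    then show "?p \<in> {p. p permutes ?S \<and> p 0 = 0 \<and> p 1 = 1}"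
      using permutes_subset[OF p, of ?S] permutes_not_in[OF p, of 0] permutes_not_in[OF p, of 1]
      by simp
  qed
  finally have sum_T: "(\<Sum>p | p permutes ?S. T p) = of_nat (2 * Suc n) * (A $$ (0, 1) *
      (\<Sum>q | q permutes {0 ..< 2 * n}. signof q * (\<Prod>l = 0 ..< n. ?B $$ (q (2 * l), q (2 * l + 1)))))"
    (is "_ = _ * (_ * ?Z)") by (simp only: sum_distrib_left)
  have "pfaffian A = of_nat (2 * Suc n) * (A $$ (0, 1) * ?Z) / (2 ^ Suc n * fact (Suc n))"
    unfolding pfaffian_permutation_sum[OF A] T_def[symmetric] sum_T ..
  also have "\<dots> = A $$ (0, 1) * (?Z / (2 ^ n * fact n))"
    using of_nat_neq_0[of n, where 'a = 'a]
    by (simp only: of_nat_mult of_nat_numeral power_Suc fact_Suc) (simp add: field_simps del: of_nat_Suc)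
  also have "?Z / (2 ^ n * fact n) = pfaffian ?B"
    by (rule pfaffian_permutation_sum[symmetric]) simp
  finally show ?thesis .
qed

lemma det_expand_first_row_col:
  fixes A :: "'a :: comm_ring_1 mat"
  assumes A: "A \<in> carrier_mat (n + 2) (n + 2)"
    and skew_A: "A\<^sup>T = - A"
    and row0: "\<And>j. j < n + 2 \<Longrightarrow> j \<noteq> 1 \<Longrightarrow> A $$ (0, j) = 0"
  shows "det A = (A $$ (0, 1))\<^sup>2 * det (mat n n (\<lambda>(i, j). A $$ (i + 2, j + 2)))"
proof -
  let ?D = "mat_delete A 0 1"
  note skew = skew_mat_entry[OF A skew_A]
  have D: "?D \<in> carrier_mat (n + 1) (n + 1)"
    using A by (simp add: mat_delete_carrier mat_delete_def)
  have D_col: "?D $$ (i, 0) = (if i = 0 then - A $$ (0, 1) else 0)" if "i < n + 1" for i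
    using that A skew[of 0 "Suc i"] row0[of "Suc i"] by (auto simp: mat_delete_def)
  have "det A = (\<Sum>j < n + 2. A $$ (0, j) * cofactor A 0 j)"
    by (rule laplace_expansion_row[OF A]) simp
  also have "\<dots> = (\<Sum>j\<in>{1}. A $$ (0, j) * cofactor A 0 j)"
    by (rule sum.mono_neutral_right) (auto simp: row0)
  also have "\<dots> = - A $$ (0, 1) * det ?D"
    by (simp add: cofactor_def)
  also have "det ?D = (\<Sum>i < n + 1. ?D $$ (i, 0) * cofactor ?D i 0)"
    by (rule laplace_expansion_column[OF D]) simp
  also have "\<dots> = (\<Sum>i\<in>{0}. ?D $$ (i, 0) * cofactor ?D i 0)"
    by (rule sum.mono_neutral_right) (use D_col in auto)
  also have "\<dots> = - A $$ (0, 1) * det (mat_delete ?D 0 0)"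
    using D_col by (simp add: cofactor_def)
  also have "mat_delete ?D 0 0 = mat n n (\<lambda>(i, j). A $$ (i + 2, j + 2))"
    using A by (intro eq_matI) (auto simp: mat_delete_def)
  finally show ?thesis by (simp add: power2_eq_square mult_ac)
qed

section \<open>The determinant as the square of the Pfaffian\<close>

lemma congruence_entry:
  fixes A P :: "'a :: comm_ring_1 mat"
  assumes "A \<in> carrier_mat n n" "P \<in> carrier_mat n n" "i < n" "j < n"
  shows "(P * A * P\<^sup>T) $$ (i, j) = (\<Sum>k = 0 ..< n. P $$ (i, k) * (\<Sum>h = 0 ..< n. A $$ (k, h) * P $$ (j, h)))"
  using assms by (simp add: scalar_prod_def)

lemma skew_congruence:
  fixes A P :: "'a :: comm_ring_1 mat"
  assumes A: "A \<in> carrier_mat n n" and P: "P \<in> carrier_mat n n" and skew: "A\<^sup>T = - A"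
  shows "(P * A * P\<^sup>T)\<^sup>T = - (P * A * P\<^sup>T)"
proof -
  have "(P * A * P\<^sup>T)\<^sup>T = P * (P * A)\<^sup>T"
    using A P by (subst transpose_mult[of _ n n _ n]) auto
  also have "(P * A)\<^sup>T = - A * P\<^sup>T"
    using A P by (subst transpose_mult[of _ n n _ n]) (auto simp: skew)
  finally show ?thesis
    using A P by (simp add: assoc_mult_mat[of _ n n _ n _ n])
qed

lemma det_congruence:
  fixes A P :: "'a :: comm_ring_1 mat"
  assumes "A \<in> carrier_mat n n" "P \<in> carrier_mat n n"
  shows "det (P * A * P\<^sup>T) = (det P)\<^sup>2 * det A"
  using assms by (simp add: det_mult[of _ n] det_transpose power2_eq_square mult_ac)

lemma det_lower_unitriangular:
  fixes P :: "'a :: comm_ring_1 mat"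
  assumes P: "P \<in> carrier_mat n n"
    and "\<And>i j. i < j \<Longrightarrow> j < n \<Longrightarrow> P $$ (i, j) = 0" and "\<And>i. i < n \<Longrightarrow> P $$ (i, i) = 1"
  shows "det P = 1"
  using assms by (subst det_lower_triangular[OF assms(2) P]) (auto simp: prod_list_diag_prod)

text \<open>
  Symmetric Gaussian elimination: congruence by a matrix of determinant 1 changes neither side. One
  such congruence makes the entry \<open>(0, 1)\<close> nonzero, unless the whole first row vanishes; another
  one uses this entry as a pivot to clear the rest of the first row. Then both sides expand along that
  row.
\<close>

theorem det_eq_pfaffian_square:
  fixes A :: "'a :: field_char_0 mat"
  assumes "A \<in> carrier_mat (2 * n) (2 * n)" and "A\<^sup>T = - A"
  shows "det A = (pfaffian A)\<^sup>2"
  using assms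
proof (induction n arbitrary: A)
  case 0
  then show ?case by (simp add: pfaffian_0x0)
next
  case (Suc n A)
  let ?N = "2 * Suc n"
  have congruent: "det M = (pfaffian M)\<^sup>2"
    if "det (P * M * P\<^sup>T) = (pfaffian (P * M * P\<^sup>T))\<^sup>2" "det P = 1"
      "M \<in> carrier_mat ?N ?N" "P \<in> carrier_mat ?N ?N" for M P :: "'a mat"
    using that det_congruence[of M ?N P] pfaffian_congruence[of M "Suc n" P] by simp
  have cleared: "det M = (pfaffian M)\<^sup>2"
    if M: "M \<in> carrier_mat ?N ?N" "M\<^sup>T = - M"
      and row0: "\<And>j. j < ?N \<Longrightarrow> j \<noteq> 1 \<Longrightarrow> M $$ (0, j) = 0" for M :: "'a mat"
  proof -
    let ?B = "mat (2 * n) (2 * n) (\<lambda>(i, j). M $$ (i + 2, j + 2))"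
    have "?B\<^sup>T = - ?B"
    proof (rule eq_matI)
      fix i j assume "i < dim_row (- ?B)" "j < dim_col (- ?B)"
      then show "?B\<^sup>T $$ (i, j) = (- ?B) $$ (i, j)"
        using skew_mat_entry[OF M, of "i + 2" "j + 2"] by simp
    qed auto
    then have "det ?B = (pfaffian ?B)\<^sup>2" by (intro Suc.IH) auto
    then show ?thesis
      using pfaffian_expand_first_row[OF M row0] det_expand_first_row_col[of M "2 * n"] M row0
      by (simp add: power_mult_distrib)
  qed
  have pivot: "det M = (pfaffian M)\<^sup>2"
    if M: "M \<in> carrier_mat ?N ?N" "M\<^sup>T = - M" and nz: "M $$ (0, 1) \<noteq> 0" for M :: "'a mat"
  proof -
    define L where "L = mat ?N ?N
      (\<lambda>(i, j). if i = j then 1 else if j = 1 \<and> 2 \<le> i then - M $$ (0, i) / M $$ (0, 1) else 0)"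
    have L: "L \<in> carrier_mat ?N ?N" by (simp add: L_def)
    have "det L = 1" by (rule det_lower_unitriangular[OF L]) (auto simp: L_def)
    moreover have "det (L * M * L\<^sup>T) = (pfaffian (L * M * L\<^sup>T))\<^sup>2"
    proof (rule cleared)
      show "(L * M * L\<^sup>T)\<^sup>T = - (L * M * L\<^sup>T)" by (rule skew_congruence[OF M(1) L M(2)])
      fix j assume j: "j < ?N" "j \<noteq> 1"
      have M00: "M $$ (0, 0) = 0" using skew_mat_entry[OF M, of 0 0] by simp
      have "(L * M * L\<^sup>T) $$ (0, j) =
          (\<Sum>k = 0 ..< ?N. L $$ (0, k) * (\<Sum>h = 0 ..< ?N. M $$ (k, h) * L $$ (j, h)))"
        by (rule congruence_entry[OF M(1) L _ j(1)]) simp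
      also have "\<dots> = (\<Sum>k\<in>{0}. L $$ (0, k) * (\<Sum>h = 0 ..< ?N. M $$ (k, h) * L $$ (j, h)))"
        by (rule sum.mono_neutral_right) (auto simp: L_def)
      also have "\<dots> = (\<Sum>h = 0 ..< ?N. M $$ (0, h) * L $$ (j, h))"
        by (simp add: L_def)
      also have "\<dots> = (\<Sum>h\<in>{1, j}. M $$ (0, h) * L $$ (j, h))"
        by (rule sum.mono_neutral_right) (use j in \<open>auto simp: L_def\<close>)
      also have "\<dots> = 0"
        using j nz M00 by (cases "j = 0") (auto simp: L_def)
      finally show "(L * M * L\<^sup>T) $$ (0, j) = 0" .
    qed (use L M in auto)
    ultimately show ?thesis using congruent L M by blast
  qed
  show ?case
  proof (cases "\<forall>j < ?N. j \<noteq> 1 \<longrightarrow> A $$ (0, j) = 0")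
    case True
    then show ?thesis by (intro cleared Suc.prems) auto
  next
    case False
    then obtain c where c: "c < ?N" "c \<noteq> 1" "A $$ (0, c) \<noteq> 0" by auto
    have "A $$ (0, 0) = 0" using skew_mat_entry[OF Suc.prems, of 0 0] by simp
    with c have "c \<noteq> 0" by metis
    show ?thesis
    proof (cases "A $$ (0, 1) = 0")
      case False
      then show ?thesis by (intro pivot Suc.prems)
    next
      case True
      define P where "P = addrow_mat ?N (1 :: 'a) 1 c"
      have P: "P \<in> carrier_mat ?N ?N" by (simp add: P_def)
      have "det P = 1" unfolding P_def by (rule det_addrow_mat) (use c in simp)
      moreover have "det (P * A * P\<^sup>T) = (pfaffian (P * A * P\<^sup>T))\<^sup>2"
      proof (rule pivot)
        show "(P * A * P\<^sup>T)\<^sup>T = - (P * A * P\<^sup>T)" by (rule skew_congruence[OF Suc.prems(1) P Suc.prems(2)])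
        have "(P * A * P\<^sup>T) $$ (0, 1) =
            (\<Sum>k = 0 ..< ?N. P $$ (0, k) * (\<Sum>h = 0 ..< ?N. A $$ (k, h) * P $$ (1, h)))"
          by (rule congruence_entry[OF Suc.prems(1) P]) simp_all
        also have "\<dots> = (\<Sum>k\<in>{0}. P $$ (0, k) * (\<Sum>h = 0 ..< ?N. A $$ (k, h) * P $$ (1, h)))"
          by (rule sum.mono_neutral_right) (auto simp: P_def addrow_mat_def)
        also have "\<dots> = (\<Sum>h = 0 ..< ?N. A $$ (0, h) * P $$ (1, h))"
          by (simp add: P_def addrow_mat_def)
        also have "\<dots> = (\<Sum>h\<in>{1, c}. A $$ (0, h) * P $$ (1, h))"
          by (rule sum.mono_neutral_right) (use c in \<open>auto simp: P_def addrow_mat_def\<close>)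
        also have "\<dots> = A $$ (0, c)"
          using c True by (simp add: P_def addrow_mat_def)
        finally show "(P * A * P\<^sup>T) $$ (0, 1) \<noteq> 0" using c by simp
      qed (use P Suc.prems in auto)
      ultimately show ?thesis using congruent P Suc.prems by blast
    qed
  qed
qed

section \<open>A mean value theorem for Pfaffians\<close>

text \<open>
  The bilinear form on coefficient sequences that represents \<open>(t - s) ^ D\<close> through the power
  sequences of \<open>s\<close> and \<open>t\<close>. A linear functional on polynomials in one variable enters
  as its sequence of moments. Differences and derivatives of the kernel in either variable are thus
  pairings of the moments of the respective functionals, which puts all of them into one family of
  matrices that is linear in each index.
\<close>

definition binomial_pairing :: "nat \<Rightarrow> (nat \<Rightarrow> real) \<Rightarrow> (nat \<Rightarrow> real) \<Rightarrow> real" where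
  "binomial_pairing D v w = (\<Sum>k\<le>D. (- 1) ^ k * of_nat (D choose k) * v k * w (D - k))"

definition pairing_pfaffian :: "nat \<Rightarrow> nat \<Rightarrow> (nat \<Rightarrow> nat \<Rightarrow> real) \<Rightarrow> real" where
  "pairing_pfaffian D n L = pfaffian (mat (2 * n) (2 * n) (\<lambda>(i, j). binomial_pairing D (L i) (L j)))"

lemma binomial_pairing_powers:
  "binomial_pairing D (\<lambda>k. s ^ k) (\<lambda>k. t ^ k) = (t - s) ^ D"
proof -
  have "(t - s) ^ D = (- s + t) ^ D" by simp
  also have "\<dots> = (\<Sum>k\<le>D. of_nat (D choose k) * (- s) ^ k * t ^ (D - k))"
    by (rule binomial_ring)
  finally show ?thesis
    unfolding binomial_pairing_def by (simp add: power_minus[of s] mult_ac)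
qed

lemma binomial_pairing_diff:
  "binomial_pairing D (\<lambda>k. a k - b k) (\<lambda>k. c k - d k) =
    binomial_pairing D a c - binomial_pairing D a d - binomial_pairing D b c + binomial_pairing D b d"
  unfolding binomial_pairing_def sum_subtractf[symmetric] sum.distrib[symmetric]
  by (intro sum.cong refl) (simp add: algebra_simps)

text \<open>
  The mixed second derivative of \<open>(t - s) ^ (D + 2)\<close>.
\<close>

lemma binomial_pairing_power_derivs:
  "binomial_pairing (D + 2) (\<lambda>k. of_nat k * s ^ (k - 1)) (\<lambda>k. of_nat k * t ^ (k - 1)) =
    - (real (D + 2) * real (D + 1) * (t - s) ^ D)"
proof -
  let ?f = "\<lambda>k. (- 1) ^ k * real (D + 2 choose k) * (of_nat k * s ^ (k - 1)) *
      (of_nat (D + 2 - k) * t ^ (D + 2 - k - 1))"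
  have coeff: "real (D + 2 choose Suc k) * real (Suc k) * real (Suc (D - k)) =
      real (D + 2) * real (D + 1) * real (D choose k)" if "k \<le> D" for k
  proof -
    have "Suc k * (D + 2 choose Suc k) = (D + 2) * (D + 1 choose k)"
      using Suc_times_binomial[of k "D + 1"] by simp
    moreover have "Suc (D - k) * (D + 1 choose k) = (D + 1) * (D choose k)"
      using Suc_times_binomial[of "D - k" D] binomial_symmetric[of k "D + 1"]
        binomial_symmetric[of k D] that by (simp add: Suc_diff_le)
    ultimately have "(D + 2 choose Suc k) * Suc k * Suc (D - k) = (D + 2) * (D + 1) * (D choose k)"
      by (metis mult.assoc mult.commute)
    then show ?thesis by (metis of_nat_mult)
  qed
  have "binomial_pairing (D + 2) (\<lambda>k. of_nat k * s ^ (k - 1)) (\<lambda>k. of_nat k * t ^ (k - 1)) = (\<Sum>k\<le>Suc (Suc D). ?f k)"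
    by (simp add: binomial_pairing_def)
  also have "\<dots> = (\<Sum>k\<le>D. ?f (Suc k))"
    by (subst sum.atMost_Suc_shift) (simp add: sum.atMost_Suc)
  also have "\<dots> = (\<Sum>k\<le>D. - (real (D + 2) * real (D + 1)) *
      ((- 1) ^ k * of_nat (D choose k) * s ^ k * t ^ (D - k)))"
  proof (rule sum.cong[OF refl])
    fix k assume "k \<in> {..D}"
    then have k: "k \<le> D" by simp
    then have "?f (Suc k) = - ((- 1) ^ k * s ^ k * t ^ (D - k)) *
        (real (D + 2 choose Suc k) * real (Suc k) * real (Suc (D - k)))"
      by (simp add: Suc_diff_le del: of_nat_Suc binomial_Suc_Suc)
    then show "?f (Suc k) = - (real (D + 2) * real (D + 1)) *
      ((- 1) ^ k * of_nat (D choose k) * s ^ k * t ^ (D - k))"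
      unfolding coeff[OF k] by (simp add: mult_ac)
  qed
  also have "\<dots> = - (real (D + 2) * real (D + 1)) * binomial_pairing D (\<lambda>k. s ^ k) (\<lambda>k. t ^ k)"
    unfolding binomial_pairing_def sum_distrib_left ..
  finally show ?thesis by (simp add: binomial_pairing_powers)
qed

text \<open>
  In each term of the permutation sum, the index \<open>i\<close> occurs in exactly one factor and only once
  there.
\<close>

lemma pairing_pfaffian_linear:
  assumes i: "i < 2 * n"
  obtains c where "\<And>g. pairing_pfaffian D n (L(i := g)) = (\<Sum>k\<le>D. c k * g k)"
proof -
  let ?Perm = "{p. p permutes {0 ..< 2 * n}}"
  let ?prod = "\<lambda>p g. \<Prod>l = 0 ..< n.
      binomial_pairing D ((L(i := g)) (p (2 * l))) ((L(i := g)) (p (2 * l + 1)))"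
  have "\<exists>c. \<forall>g. ?prod p g = (\<Sum>k\<le>D. c k * g k)" if p: "p permutes {0 ..< 2 * n}" for p
  proof -
    obtain s where s: "p s = i" using permutes_surj[OF p] by (metis surjD)
    have s_lt: "s < 2 * n" using permutes_in_image[OF p, of s] i s by simp
    define l where "l = s div 2"
    have l: "l < n" using s_lt by (simp add: l_def)
    have hit: "p t = i \<longleftrightarrow> t = s" for t
      using s permutes_inj[OF p] by (auto dest: injD)
    define C where "C = (\<Prod>l\<in>{0 ..< n} - {l}. binomial_pairing D (L (p (2 * l))) (L (p (2 * l + 1))))"
    have C: "(\<Prod>l\<in>{0 ..< n} - {l}. binomial_pairing D
        ((L(i := g)) (p (2 * l))) ((L(i := g)) (p (2 * l + 1)))) = C" for g
      unfolding C_def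
    proof (rule prod.cong[OF refl])
      fix k assume "k \<in> {0 ..< n} - {l}"
      then have "2 * k \<noteq> s" "2 * k + 1 \<noteq> s" by (auto simp: l_def)
      then show "binomial_pairing D ((L(i := g)) (p (2 * k))) ((L(i := g)) (p (2 * k + 1))) =
          binomial_pairing D (L (p (2 * k))) (L (p (2 * k + 1)))"
        by (simp add: hit)
    qed
    have split: "?prod p g = binomial_pairing D ((L(i := g)) (p (2 * l))) ((L(i := g)) (p (2 * l + 1))) * C" for g
      by (subst prod.remove[of _ l]) (use l C in auto)
    show ?thesis
    proof (cases "even s")
      case True
      then have "s = 2 * l" by (simp add: l_def)
      then have "?prod p g = (\<Sum>k\<le>D.
          ((- 1) ^ k * of_nat (D choose k) * L (p (2 * l + 1)) (D - k) * C) * g k)" for g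
        unfolding split using hit[of "2 * l"] hit[of "2 * l + 1"]
        by (simp add: binomial_pairing_def sum_distrib_left sum_distrib_right mult_ac)
      then show ?thesis by (intro exI[of _ "\<lambda>k. (- 1) ^ k * of_nat (D choose k) * L (p (2 * l + 1)) (D - k) * C"]) blast
    next
      case False
      then have "s = 2 * l + 1" by (simp add: l_def)
      then have "?prod p g = (\<Sum>k\<le>D.
          ((- 1) ^ k * of_nat (D choose k) * L (p (2 * l)) k * C) * g (D - k))" for g
        unfolding split using hit[of "2 * l"] hit[of "2 * l + 1"]
        by (simp add: binomial_pairing_def sum_distrib_left sum_distrib_right mult_ac)
      moreover have "(\<Sum>k\<le>D. ((- 1) ^ k * of_nat (D choose k) * L (p (2 * l)) k * C) * g (D - k)) =
          (\<Sum>k\<le>D. ((- 1) ^ (D - k) * of_nat (D choose (D - k)) * L (p (2 * l)) (D - k) * C) * g k)" for g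
        by (rule sum.reindex_bij_witness[of _ "\<lambda>k. D - k" "\<lambda>k. D - k"]) auto
      ultimately show ?thesis
        by (intro exI[of _ "\<lambda>k. (- 1) ^ (D - k) * of_nat (D choose (D - k)) * L (p (2 * l)) (D - k) * C"]) presburger
    qed
  qed
  then have "\<forall>p\<in>?Perm. \<exists>c. \<forall>g. ?prod p g = (\<Sum>k\<le>D. c k * g k)" by simp
  then obtain c where c: "\<forall>p\<in>?Perm. \<forall>g. ?prod p g = (\<Sum>k\<le>D. c p k * g k)"
    by (rule bchoice[THEN exE])
  have "pairing_pfaffian D n (L(i := g)) =
      (\<Sum>k\<le>D. ((\<Sum>p\<in>?Perm. signof p * c p k) / (2 ^ n * fact n)) * g k)" for g
  proof -
    have lt: "p t < 2 * n" if "p permutes {0 ..< 2 * n}" "t < 2 * n" for p t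
      using permutes_in_image[OF that(1), of t] that by auto
    have "pairing_pfaffian D n (L(i := g)) = (\<Sum>p\<in>?Perm. signof p * ?prod p g) / (2 ^ n * fact n)"
      unfolding pairing_pfaffian_def
      by (subst pfaffian_permutation_sum[of _ n])
        (auto simp del: fun_upd_apply simp: lt intro!: sum.cong prod.cong arg_cong2[where f = "(/)"])
    also have "(\<Sum>p\<in>?Perm. signof p * ?prod p g) = (\<Sum>p\<in>?Perm. signof p * (\<Sum>k\<le>D. c p k * g k))"
      using c by (intro sum.cong refl arg_cong2[where f = "(*)"]) blast
    also have "\<dots> = (\<Sum>k\<le>D. (\<Sum>p\<in>?Perm. signof p * c p k) * g k)"
      unfolding sum_distrib_left sum_distrib_right by (subst sum.swap) (simp add: mult_ac)
    also have "\<dots> / (2 ^ n * fact n) =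
        (\<Sum>k\<le>D. ((\<Sum>p\<in>?Perm. signof p * c p k) / (2 ^ n * fact n)) * g k)"
      by (subst sum_divide_distrib) simp
    finally show ?thesis .
  qed
  then show thesis by (rule that)
qed

text \<open>
  By linearity, inserting the powers of \<open>t\<close> at the index \<open>i\<close> gives a polynomial in
  \<open>t\<close>, and inserting their derivatives gives its derivative; so this is the mean value theorem for
  that polynomial.
\<close>

lemma pairing_pfaffian_mvt:
  assumes i: "i < 2 * n" and "a < b"
  obtains \<xi> where "a < \<xi>" "\<xi> < b"
    "pairing_pfaffian D n (L(i := \<lambda>k. b ^ k - a ^ k)) =
      (b - a) * pairing_pfaffian D n (L(i := \<lambda>k. of_nat k * \<xi> ^ (k - 1)))"
proof -
  obtain c where c: "\<And>g. pairing_pfaffian D n (L(i := g)) = (\<Sum>k\<le>D. c k * g k)"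
    using pairing_pfaffian_linear[OF i] by blast
  have deriv: "((\<lambda>t. \<Sum>k\<le>D. c k * t ^ k) has_real_derivative
      (\<Sum>k\<le>D. c k * (of_nat k * t ^ (k - 1)))) (at t)" for t
    by (auto intro!: derivative_eq_intros simp: mult_ac)
  obtain \<xi> where "a < \<xi>" "\<xi> < b"
    "(\<Sum>k\<le>D. c k * b ^ k) - (\<Sum>k\<le>D. c k * a ^ k) = (b - a) * (\<Sum>k\<le>D. c k * (of_nat k * \<xi> ^ (k - 1)))"
    using MVT2[OF \<open>a < b\<close> deriv] by blast
  then show thesis
    by (intro that[of \<xi>]) (simp_all add: c right_diff_distrib sum_subtractf)
qed

text \<open>
  The indices below \<open>s\<close> have been converted from differences to derivatives.
\<close>

lemma pairing_pfaffian_mvt_all: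
  assumes ab: "\<And>i. i < 2 * n \<Longrightarrow> a i < b i" and "s \<le> 2 * n"
  shows "\<exists>\<xi>. (\<forall>i<s. a i < \<xi> i \<and> \<xi> i < b i) \<and>
    pairing_pfaffian D n (\<lambda>i k. b i ^ k - a i ^ k) = (\<Prod>i<s. b i - a i) *
      pairing_pfaffian D n (\<lambda>i. if i < s then (\<lambda>k. of_nat k * \<xi> i ^ (k - 1)) else (\<lambda>k. b i ^ k - a i ^ k))"
  using \<open>s \<le> 2 * n\<close>
proof (induction s)
  case (Suc s)
  then obtain \<xi> where \<xi>: "\<forall>i<s. a i < \<xi> i \<and> \<xi> i < b i"
    "pairing_pfaffian D n (\<lambda>i k. b i ^ k - a i ^ k) = (\<Prod>i<s. b i - a i) *
      pairing_pfaffian D n (\<lambda>i. if i < s then (\<lambda>k. of_nat k * \<xi> i ^ (k - 1)) else (\<lambda>k. b i ^ k - a i ^ k))"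
    by auto
  let ?L = "\<lambda>i. if i < s then (\<lambda>k. of_nat k * \<xi> i ^ (k - 1)) else (\<lambda>k. b i ^ k - a i ^ k)"
  obtain z where z: "a s < z" "z < b s"
    "pairing_pfaffian D n (?L(s := \<lambda>k. b s ^ k - a s ^ k)) =
      (b s - a s) * pairing_pfaffian D n (?L(s := \<lambda>k. of_nat k * z ^ (k - 1)))"
    by (rule pairing_pfaffian_mvt[of s n "a s" "b s" D ?L]) (use ab Suc.prems in auto)
  have "?L(s := \<lambda>k. b s ^ k - a s ^ k) = ?L" by auto
  moreover have "?L(s := \<lambda>k. of_nat k * z ^ (k - 1)) = (\<lambda>i. if i < Suc s
      then (\<lambda>k. of_nat k * (\<xi>(s := z)) i ^ (k - 1)) else (\<lambda>k. b i ^ k - a i ^ k))"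
    by (auto simp: fun_eq_iff less_Suc_eq)
  ultimately show ?case
    using \<xi> z by (intro exI[of _ "\<xi>(s := z)"]) (simp add: less_Suc_eq)
qed simp

section \<open>Pfaffians of odd powers of differences\<close>

lemma skew_odd_power_matrix: "(odd_power_matrix m r x)\<^sup>T = - odd_power_matrix m r x"
proof (rule eq_matI)
  fix i j assume "i < dim_row (- odd_power_matrix m r x)" "j < dim_col (- odd_power_matrix m r x)"
  moreover have "(x i - x j) ^ (2 * r + 1) = - ((x j - x i) ^ (2 * r + 1))"
    using power_minus_odd[of "2 * r + 1" "x j - x i"] by simp
  ultimately show "(odd_power_matrix m r x)\<^sup>T $$ (i, j) = (- odd_power_matrix m r x) $$ (i, j)"
    by (simp add: odd_power_matrix_def)
qed (simp_all add: odd_power_matrix_def)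

lemma odd_power_matrix_carrier [simp]: "odd_power_matrix m r x \<in> carrier_mat (2 * m) (2 * m)"
  by (simp add: odd_power_matrix_def)

text \<open>
  With \<open>u i = x i - x 0\<close> one has
  \<open>(x j - x i) / (u i * u j) = 1 / u i - 1 / u j = y (j - 1) - y (i - 1)\<close>, where \<open>y\<close> is
  numbered from 0. The matrix \<open>P\<close> in the proof performs the scaling by \<open>1 / u i ^ D\<close> and the
  subtraction of consecutive rows in one congruence.
\<close>

lemma pfaffian_first_point_to_infinity:
  assumes x: "strict_mono_on {0 ..< 2 * Suc m} x"
  obtains y C where "strict_mono_on {0 ..< 2 * m + 1} y" "C > 0"
    "pfaffian (odd_power_matrix (Suc m) r x) =
      C * pairing_pfaffian (2 * r + 1) m (\<lambda>i k. y (i + 1) ^ k - y i ^ k)"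
proof -
  let ?N = "2 * Suc m" and ?D = "2 * r + 1"
  define A where "A = odd_power_matrix (Suc m) r x"
  define u where "u i = x i - x 0" for i
  define y where "y i = - 1 / u (i + 1)" for i
  define w where "w i = (if i = 0 then 1 else 1 / u i ^ ?D)" for i
  define P where "P = mat ?N ?N
    (\<lambda>(i, j). (if j = i then w i else 0) - (if j = i - 1 then if 2 \<le> i then w (i - 1) else 0 else 0))"
  have A: "A \<in> carrier_mat ?N ?N" unfolding A_def by (rule odd_power_matrix_carrier)
  have P: "P \<in> carrier_mat ?N ?N" by (simp add: P_def)
  have A_entry: "A $$ (i, j) = (u j - u i) ^ ?D" if "i < ?N" "j < ?N" for i j
    using that by (simp add: A_def odd_power_matrix_def u_def)
  have u_pos: "u i > 0" if "0 < i" "i < ?N" for i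
    using strict_mono_onD[OF x, of 0 i] that by (simp add: u_def)
  have w_pos: "w i > 0" if "i < ?N" for i
    using u_pos[of i] that by (simp add: w_def)
  have w_0: "w 0 = 1" by (simp add: w_def)
  have y_mono: "strict_mono_on {0 ..< 2 * m + 1} y"
  proof (rule strict_mono_onI)
    fix i j assume "i \<in> {0 ..< 2 * m + 1}" "j \<in> {0 ..< 2 * m + 1}" "i < j"
    then have "u (i + 1) < u (j + 1)" "0 < u (i + 1)"
      using strict_mono_onD[OF x, of "i + 1" "j + 1"] u_pos[of "i + 1"] by (auto simp: u_def)
    then show "y i < y j" by (simp add: y_def frac_less2)
  qed
  have A_scaled: "w i * w j * A $$ (i, j) = (y (j - 1) - y (i - 1)) ^ ?D"
    if "0 < i" "i < ?N" "0 < j" "j < ?N" for i j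
  proof -
    have "w i * w j * A $$ (i, j) = ((u j - u i) / (u i * u j)) ^ ?D"
      using that A_entry[of i j] by (simp add: w_def power_divide power_mult_distrib)
    also have "(u j - u i) / (u i * u j) = y (j - 1) - y (i - 1)"
      using that u_pos[of i] u_pos[of j] by (simp add: y_def field_simps)
    finally show ?thesis .
  qed
  have A_scaled_0: "w j * A $$ (0, j) = 1" if "0 < j" "j < ?N" for j
    using that u_pos[of j] A_entry[of 0 j] by (simp add: w_def u_def)
  have P_sum: "(\<Sum>k = 0 ..< ?N. P $$ (i, k) * f k) =
      w i * f i - (if 2 \<le> i then w (i - 1) * f (i - 1) else 0)" if "i < ?N" for i f
  proof -
    have "(\<Sum>k = 0 ..< ?N. P $$ (i, k) * f k) = (\<Sum>k = 0 ..< ?N. (if k = i then w i * f i else 0) -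
        (if k = i - 1 then if 2 \<le> i then w (i - 1) * f (i - 1) else 0 else 0))"
      using that by (intro sum.cong refl) (auto simp: P_def algebra_simps)
    moreover have "i - 1 < ?N" using that by simp
    ultimately show ?thesis using that
      by (simp add: sum_subtractf del: sum.op_ivl_Suc mult_Suc_right)
  qed
  define M where "M = P * A * P\<^sup>T"
  have M: "M \<in> carrier_mat ?N ?N" using A P by (simp add: M_def)
  have M_skew: "M\<^sup>T = - M"
    unfolding M_def using A P skew_odd_power_matrix by (intro skew_congruence) (auto simp: A_def)
  have M_entry: "M $$ (i, j) =
      w i * (w j * A $$ (i, j) - (if 2 \<le> j then w (j - 1) * A $$ (i, j - 1) else 0)) -
      (if 2 \<le> i then w (i - 1) * (w j * A $$ (i - 1, j) -
        (if 2 \<le> j then w (j - 1) * A $$ (i - 1, j - 1) else 0)) else 0)" if "i < ?N" "j < ?N" for i j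
    unfolding M_def congruence_entry[OF A P that] P_sum[OF that(1)]
    using P_sum[OF that(2)] by (simp only: mult.commute[of "A $$ _"])
  have M_01: "M $$ (0, 1) = 1"
    using M_entry[of 0 1] A_scaled_0[of 1] w_0 by simp
  have M_row0: "M $$ (0, j) = 0" if "j < ?N" "j \<noteq> 1" for j
  proof (cases "j = 0")
    case True
    then show ?thesis using M_entry[of 0 0] A_entry[of 0 0] by simp
  next
    case False
    then show ?thesis
      using that M_entry[of 0 j] A_scaled_0[of j] A_scaled_0[of "j - 1"] w_0 by simp
  qed
  have M_diff: "M $$ (i + 2, j + 2) = binomial_pairing ?D
      (\<lambda>k. y (i + 1) ^ k - y i ^ k) (\<lambda>k. y (j + 1) ^ k - y j ^ k)" if "i < 2 * m" "j < 2 * m" for i j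
  proof -
    have "M $$ (i + 2, j + 2) = w (i + 2) * w (j + 2) * A $$ (i + 2, j + 2)
        - w (i + 2) * w (j + 1) * A $$ (i + 2, j + 1)
        - w (i + 1) * w (j + 2) * A $$ (i + 1, j + 2)
        + w (i + 1) * w (j + 1) * A $$ (i + 1, j + 1)"
      using that M_entry[of "i + 2" "j + 2"] by (simp add: algebra_simps)
    also have "\<dots> = (y (j + 1) - y (i + 1)) ^ ?D - (y j - y (i + 1)) ^ ?D
        - (y (j + 1) - y i) ^ ?D + (y j - y i) ^ ?D"
      using that A_scaled[of "i + 2" "j + 2"] A_scaled[of "i + 2" "j + 1"]
        A_scaled[of "i + 1" "j + 2"] A_scaled[of "i + 1" "j + 1"] by simp
    finally show ?thesis
      unfolding binomial_pairing_diff binomial_pairing_powers .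
  qed
  have "pfaffian M = pfaffian (mat (2 * m) (2 * m) (\<lambda>(i, j). M $$ (i + 2, j + 2)))"
    using pfaffian_expand_first_row[OF M M_skew M_row0] M_01 by simp
  also have "mat (2 * m) (2 * m) (\<lambda>(i, j). M $$ (i + 2, j + 2)) = mat (2 * m) (2 * m)
      (\<lambda>(i, j). binomial_pairing ?D (\<lambda>k. y (i + 1) ^ k - y i ^ k) (\<lambda>k. y (j + 1) ^ k - y j ^ k))"
    by (rule cong_mat) (use M_diff in auto)
  finally have pf_M: "pfaffian M = pairing_pfaffian ?D m (\<lambda>i k. y (i + 1) ^ k - y i ^ k)"
    by (simp add: pairing_pfaffian_def)
  have "det P = (\<Prod>i = 0 ..< ?N. P $$ (i, i))"
    using P by (subst det_lower_triangular[OF _ P]) (auto simp: P_def prod_list_diag_prod)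
  also have "\<dots> = (\<Prod>i = 0 ..< ?N. w i)"
    by (intro prod.cong refl) (auto simp: P_def)
  finally have det_P: "det P > 0" using w_pos by (simp only:) (rule prod_pos, simp)
  have "pfaffian M = det P * pfaffian A"
    unfolding M_def by (rule pfaffian_congruence[OF A P])
  then have "pfaffian A = (1 / det P) * pairing_pfaffian ?D m (\<lambda>i k. y (i + 1) ^ k - y i ^ k)"
    using det_P pf_M by (simp add: field_simps)
  then show thesis
    using det_P by (intro that[OF y_mono, of "1 / det P"]) (simp_all only: A_def zero_less_divide_1_iff)
qed

text \<open>
  The points \<open>\<xi> i\<close> come from the mean value theorem and lie in the consecutive intervals
  between the \<open>y i\<close>, hence they are increasing. The sign \<open>(- 1) ^ m\<close> stems from the
  negative factor of the second derivative, which the Pfaffian of size \<open>2 * m\<close> raises to the power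
  \<open>m\<close>.
\<close>

lemma pfaffian_power_differences:
  assumes y: "strict_mono_on {0 ..< 2 * m + 1} y"
  obtains \<xi> C where "strict_mono_on {0 ..< 2 * m} \<xi>" "C > 0"
    "pairing_pfaffian (2 * Suc r + 1) m (\<lambda>i k. y (i + 1) ^ k - y i ^ k) =
      (- 1) ^ m * C * pfaffian (odd_power_matrix m r \<xi>)"
proof -
  let ?D = "2 * r + 1"
  let ?c = "real (?D + 2) * real (?D + 1)"
  have y_less: "y i < y (i + 1)" if "i < 2 * m" for i
    using strict_mono_onD[OF y, of i "i + 1"] that by simp
  obtain \<xi> where \<xi>: "\<And>i. i < 2 * m \<Longrightarrow> y i < \<xi> i \<and> \<xi> i < y (i + 1)"
    and mvt: "pairing_pfaffian (?D + 2) m (\<lambda>i k. y (i + 1) ^ k - y i ^ k) =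
      (\<Prod>i<2 * m. y (i + 1) - y i) * pairing_pfaffian (?D + 2) m
        (\<lambda>i. if i < 2 * m then (\<lambda>k. of_nat k * \<xi> i ^ (k - 1)) else (\<lambda>k. y (i + 1) ^ k - y i ^ k))"
    using pairing_pfaffian_mvt_all[of m y "\<lambda>i. y (i + 1)" "2 * m" "?D + 2"] y_less by blast
  have "mat (2 * m) (2 * m) (\<lambda>(i, j). binomial_pairing (?D + 2)
        ((\<lambda>i. if i < 2 * m then (\<lambda>k. of_nat k * \<xi> i ^ (k - 1)) else (\<lambda>k. y (i + 1) ^ k - y i ^ k)) i)
        ((\<lambda>i. if i < 2 * m then (\<lambda>k. of_nat k * \<xi> i ^ (k - 1)) else (\<lambda>k. y (i + 1) ^ k - y i ^ k)) j)) =
      (- ?c) \<cdot>\<^sub>m odd_power_matrix m r \<xi>"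
    using binomial_pairing_power_derivs[of ?D]
    by (intro eq_matI) (auto simp: odd_power_matrix_def)
  then have "pairing_pfaffian (?D + 2) m
        (\<lambda>i. if i < 2 * m then (\<lambda>k. of_nat k * \<xi> i ^ (k - 1)) else (\<lambda>k. y (i + 1) ^ k - y i ^ k)) =
      (- ?c) ^ m * pfaffian (odd_power_matrix m r \<xi>)"
    unfolding pairing_pfaffian_def by (simp add: pfaffian_smult)
  moreover have "(- ?c) ^ m = (- 1) ^ m * ?c ^ m" by (rule power_minus)
  ultimately have "pairing_pfaffian (2 * Suc r + 1) m (\<lambda>i k. y (i + 1) ^ k - y i ^ k) =
      (- 1) ^ m * ((\<Prod>i<2 * m. y (i + 1) - y i) * ?c ^ m) * pfaffian (odd_power_matrix m r \<xi>)"
    using mvt by (simp add: mult_ac)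
  moreover have "(\<Prod>i<2 * m. y (i + 1) - y i) * ?c ^ m > 0"
    using y_less by (intro mult_pos_pos prod_pos zero_less_power) auto
  moreover have "strict_mono_on {0 ..< 2 * m} \<xi>"
  proof (rule strict_mono_onI)
    fix i j assume ij: "i \<in> {0 ..< 2 * m}" "j \<in> {0 ..< 2 * m}" "i < j"
    then have "\<xi> i < y (i + 1)" "y j < \<xi> j" using \<xi> by auto
    moreover have "y (i + 1) \<le> y j"
      using strict_mono_on_leD[OF y, of "i + 1" j] ij by simp
    ultimately show "\<xi> i < \<xi> j" by simp
  qed
  ultimately show thesis using that by blast
qed

theorem theorem1p2:
  fixes m r :: nat and x :: "nat \<Rightarrow> real"
  assumes "m \<ge> 1"
    and "strict_mono_on {0 ..< 2 * m} x"
    and "r \<ge> m - 1"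
  shows "(- 1) ^ (m choose 2) * pfaffian (odd_power_matrix m r x) > 0 \<and>
         det (odd_power_matrix m r x) > 0"
proof
  show pf: "(- 1) ^ (m choose 2) * pfaffian (odd_power_matrix m r x) > 0"
    using assms
  proof (induction m arbitrary: r x rule: nat_induct_at_least)
    case base
    have "pfaffian (odd_power_matrix 1 r x) = (x 1 - x 0) ^ (2 * r + 1)"
    proof -
      have "pfaffian (odd_power_matrix 1 r x) = odd_power_matrix 1 r x $$ (0, 1) *
          pfaffian (mat (2 * 0) (2 * 0) (\<lambda>(i, j). odd_power_matrix 1 r x $$ (i + 2, j + 2)))"
        by (rule pfaffian_expand_first_row)
          (simp_all add: skew_odd_power_matrix, auto simp: odd_power_matrix_def dest!: less_2_cases)
      then show ?thesis by (simp add: pfaffian_0x0 odd_power_matrix_def)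
    qed
    moreover have "x 0 < x 1" using strict_mono_onD[OF base(1), of 0 1] by simp
    ultimately show ?case by (simp add: binomial_eq_0)
  next
    case (Suc m)
    then obtain r' where r: "r = Suc r'" and r': "r' \<ge> m - 1" by (cases r) auto
    obtain y C where y: "strict_mono_on {0 ..< 2 * m + 1} y" "C > 0"
      "pfaffian (odd_power_matrix (Suc m) r x) =
        C * pairing_pfaffian (2 * r + 1) m (\<lambda>i k. y (i + 1) ^ k - y i ^ k)"
      by (rule pfaffian_first_point_to_infinity[OF Suc.prems(1)])
    obtain \<xi> C' where \<xi>: "strict_mono_on {0 ..< 2 * m} \<xi>" "C' > 0"
      "pairing_pfaffian (2 * Suc r' + 1) m (\<lambda>i k. y (i + 1) ^ k - y i ^ k) =
        (- 1) ^ m * C' * pfaffian (odd_power_matrix m r' \<xi>)"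
      by (rule pfaffian_power_differences[OF y(1)])
    have "(Suc m choose 2) = m + (m choose 2)" by (simp add: numeral_2_eq_2)
    then have "(- 1) ^ (Suc m choose 2) * pfaffian (odd_power_matrix (Suc m) r x) =
        ((- 1) ^ m * (- 1) ^ m) * (C * C') * ((- 1) ^ (m choose 2) * pfaffian (odd_power_matrix m r' \<xi>))"
      using y(3) \<xi>(3) by (simp add: r power_add mult_ac)
    also have "(- 1 :: real) ^ m * (- 1) ^ m = 1" by (simp add: power_mult_distrib[symmetric])
    finally show ?case
      using Suc.IH[OF \<xi>(1) r'] y(2) \<xi>(2) by simp
  qed
  have "det (odd_power_matrix m r x) = (pfaffian (odd_power_matrix m r x))\<^sup>2"
    by (rule det_eq_pfaffian_square[OF odd_power_matrix_carrier skew_odd_power_matrix])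
  then show "det (odd_power_matrix m r x) > 0" using pf by auto
qed

end
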